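(* Let $d\ge2$ and let $E_1,E_2\subset[1,2]$ be nonempty sets with upper Minkowski dimensions $\beta_1,\beta_2$. Define $$E^*=\left\{\frac{t_1t_2}{\sqrt{t_1^2+t_2^2}}:\ t_1\in E_1,\ t_2\in E_2\right\},\qquad\beta^*=\dim_M(E^* ).$$ Let $1\le p,q\le\infty$ and $r>0$. If $\mathcal{A}^{(2)}_{\hat\sigma_{2d-1},E_1,E_2}:L^p\times L^q\to L^r$ is bounded, then $$\frac1p+\frac1q\le\frac{2d-1}{d}+\frac{1-\beta^*}{dr}.$$
   Context: $\sigma_{2d-1}$ is the normalized spherical measure on the unit sphere $S^{2d-1}\subset\mathbb{R}^{2d}$, and $$\mathcal{A}^{(2)}_{\hat\sigma_{2d-1},E_1,E_2}(f,g)(x)=\sup_{t_1\in E_1,\,t_2\in E_2}\left|\int_{S^{2d-1}}f(x-t_1y)g(x-t_2z)\,d\sigma_{2d-1}(y,z)\right|,\quad x\in\mathbb{R}^d.$$ Boundedness means that the norm of the output in $L^r(\mathbb{R}^d)$ is at most $C\|f\|_{L^p}\|g\|_{L^q}$ with $C$ independent of $f,g$. Upper Minkowski dimension of a bounded set $F\subset\mathbb{R}$: $\dim_M(F)=\limsup_{\delta\to0}\frac{\log N(F,\delta)}{\log(1/\delta)}$, where $N(F,\delta)$ is the minimal number of closed intervals of length $\delta$ needed to cover $F$. *)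

theory Defs
  imports "HOL-Probability.Probability" "HOL-Real_Asymp.Real_Asymp"
begin

section \<open>The spherical measure\<close>

text \<open>
  The normalized surface measure of the unit sphere, given by polar coordinates: the image of
  the uniform distribution on the unit ball under \<open>x \<mapsto> x / norm x\<close>. It is a Borel measure on
  the ambient space that is concentrated on the sphere. Since \<open>norm (y, z)\<close> is
  \<open>sqrt (norm y ^ 2 + norm z ^ 2)\<close>, at type \<open>(real ^ 'n) \<times> (real ^ 'n)\<close> with
  \<open>d = CARD('n)\<close> this is the measure on the unit sphere of dimension \<open>2 d - 1\<close>.
\<close>

definition sphere_measure :: "'a::euclidean_space measure" where
  "sphere_measure = distr (uniform_measure lborel (ball 0 1)) borel (\<lambda>x. x /\<^sub>R norm x)"

lemma space_sphere_measure [simp]: "space sphere_measure = UNIV"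
  and sets_sphere_measure [simp, measurable_cong]: "sets sphere_measure = sets borel"
  by (simp_all add: sphere_measure_def)

lemma emeasure_unit_ball:
  "emeasure lborel (ball (0::'a::euclidean_space) 1) \<noteq> 0"
  "emeasure lborel (ball (0::'a::euclidean_space) 1) \<noteq> \<infinity>"
  using less_imp_neq[OF unit_ball_vol_pos[of "real DIM('a)"]]
  by (simp_all add: emeasure_ball less_top)

lemma prob_space_sphere_measure: "prob_space (sphere_measure :: 'a::euclidean_space measure)"
proof -
  have "prob_space (uniform_measure lborel (ball (0::'a) 1))"
    by (rule prob_space_uniform_measure[OF emeasure_unit_ball])
  then show ?thesis
    unfolding sphere_measure_def by (rule prob_space.prob_space_distr) measurable
qed

lemma AE_sphere_measure: "AE x in (sphere_measure :: 'a::euclidean_space measure). x \<in> sphere 0 1"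
proof -
  have "AE x in lborel. (x::'a) \<noteq> 0"
    by (rule AE_lborel_singleton)
  then have "AE x in uniform_measure lborel (ball (0::'a) 1). x /\<^sub>R norm x \<in> sphere 0 1"
    by (intro AE_uniform_measureI) auto
  then show ?thesis
    unfolding sphere_measure_def by (subst AE_distr_iff) (auto simp: sphere_def)
qed


section \<open>Lebesgue norms and bounded bilinear operators\<close>

definition ennreal_powr :: "ennreal \<Rightarrow> real \<Rightarrow> ennreal" where
  "ennreal_powr x a = (if x = \<infinity> then \<infinity> else ennreal (enn2real x powr a))"

text \<open>
  The \<open>L\<^sup>p\<close> (quasi-)norm of a nonnegative extended function, for \<open>0 < p \<le> \<infinity>\<close>. The norm of a
  complex function \<open>f\<close> is that of \<open>\<lambda>x. ennreal (cmod (f x))\<close>. For \<open>p = \<infinity>\<close> this is the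
  essential supremum; \<^term>\<open>esssup\<close> is not used, as its value at functions that are measurable
  only after modification on a null set is \<^term>\<open>top\<close>.
\<close>

definition Lp_norm :: "ennreal \<Rightarrow> 'a measure \<Rightarrow> ('a \<Rightarrow> ennreal) \<Rightarrow> ennreal" where
  "Lp_norm p M f =
    (if p = \<infinity> then Inf {c. AE x in M. f x \<le> c}
     else ennreal_powr (\<integral>\<^sup>+x. ennreal_powr (f x) (enn2real p) \<partial>M) (1 / enn2real p))"

text \<open>Every class in \<open>L\<^sup>p(\<real>\<^sup>d)\<close> is taken through its Borel representatives.\<close>

definition Lp_space :: "ennreal \<Rightarrow> (real ^ 'n \<Rightarrow> complex) set" where
  "Lp_space p = {f \<in> borel_measurable borel. Lp_norm p lborel (\<lambda>x. ennreal (cmod (f x))) < \<infinity>}"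

definition bounded_bilinear_Lp ::
    "ennreal \<Rightarrow> ennreal \<Rightarrow> ennreal \<Rightarrow>
     ((real ^ 'n \<Rightarrow> complex) \<Rightarrow> (real ^ 'n \<Rightarrow> complex) \<Rightarrow> real ^ 'n \<Rightarrow> ennreal) \<Rightarrow> bool" where
  "bounded_bilinear_Lp p q r T \<longleftrightarrow>
    (\<exists>C::real. C \<ge> 0 \<and> (\<forall>f \<in> Lp_space p. \<forall>g \<in> Lp_space q.
       Lp_norm r lborel (T f g) \<le>
         ennreal C * Lp_norm p lborel (\<lambda>x. ennreal (cmod (f x)))
                   * Lp_norm q lborel (\<lambda>x. ennreal (cmod (g x)))))"


section \<open>The bilinear spherical maximal operator\<close>

text \<open>
  The supremum is taken in the extended nonnegative reals. The marginals of the spherical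
  measure on the two factors are absolutely continuous, so the integrals do not depend on the
  choice of representatives of \<open>f\<close> and \<open>g\<close>.
\<close>

definition bilinear_spherical_maximal ::
    "real set \<Rightarrow> real set \<Rightarrow> (real ^ 'n \<Rightarrow> complex) \<Rightarrow> (real ^ 'n \<Rightarrow> complex) \<Rightarrow> real ^ 'n \<Rightarrow> ennreal"
  where
  "bilinear_spherical_maximal E1 E2 f g x =
    (SUP t1\<in>E1. SUP t2\<in>E2.
       ennreal (cmod (LINT w|sphere_measure. f (x - t1 *\<^sub>R fst w) * g (x - t2 *\<^sub>R snd w))))"


section \<open>Upper Minkowski dimension\<close>

definition covering_number :: "real set \<Rightarrow> real \<Rightarrow> nat" where
  "covering_number F \<delta> = (LEAST n. \<exists>A. finite A \<and> card A = n \<and> F \<subseteq> (\<Union>a\<in>A. {a..a + \<delta>}))"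

text \<open>
  The limit superior is formed in the extended reals; for nonempty bounded \<open>F\<close> it is a real
  number, as shown below.
\<close>

definition upper_minkowski_limsup :: "real set \<Rightarrow> ereal" where
  "upper_minkowski_limsup F =
    Limsup (at_right 0) (\<lambda>\<delta>. ereal (ln (real (covering_number F \<delta>)) / ln (1 / \<delta>)))"

definition upper_minkowski_dim :: "real set \<Rightarrow> real" where
  "upper_minkowski_dim F = real_of_ereal (upper_minkowski_limsup F)"

lemma covering_exists:
  fixes a b \<delta> :: real
  assumes "F \<subseteq> {a..b}" "a \<le> b" "\<delta> > 0"
  shows "\<exists>A. finite A \<and> card A \<le> nat \<lceil>(b - a) / \<delta>\<rceil> + 1 \<and> F \<subseteq> (\<Union>a\<in>A. {a..a + \<delta>})"
proof (intro exI conjI)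
  let ?N = "nat \<lceil>(b - a) / \<delta>\<rceil>"
  let ?A = "(\<lambda>k. a + real k * \<delta>) ` {..?N}"
  show "finite ?A" by simp
  show "card ?A \<le> ?N + 1" using card_image_le[of "{..?N}" "\<lambda>k. a + real k * \<delta>"] by simp
  show "F \<subseteq> (\<Union>a\<in>?A. {a..a + \<delta>})"
  proof
    fix x assume "x \<in> F"
    then have x: "a \<le> x" "x \<le> b" using assms(1) by auto
    define k where "k = nat \<lfloor>(x - a) / \<delta>\<rfloor>"
    have nn: "(x - a) / \<delta> \<ge> 0" using x assms by simp
    then have k: "real k \<le> (x - a) / \<delta>" "(x - a) / \<delta> < real k + 1"
      unfolding k_def by linarith+
    have "(x - a) / \<delta> \<le> (b - a) / \<delta>" using x assms by (simp add: divide_right_mono)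
    then have "k \<le> ?N" unfolding k_def by linarith
    moreover have "x \<in> {a + real k * \<delta>..a + real k * \<delta> + \<delta>}"
      using k assms(3) by (auto simp: field_simps)
    ultimately show "x \<in> (\<Union>a\<in>?A. {a..a + \<delta>})" by blast
  qed
qed

lemma covering_number_props:
  assumes "bounded F" "\<delta> > 0"
  shows "\<exists>A. finite A \<and> card A = covering_number F \<delta> \<and> F \<subseteq> (\<Union>a\<in>A. {a..a + \<delta>})"
    and "\<And>A. finite A \<Longrightarrow> F \<subseteq> (\<Union>a\<in>A. {a..a + \<delta>}) \<Longrightarrow> covering_number F \<delta> \<le> card A"
proof -
  obtain a b where "F \<subseteq> {a..b}" "a \<le> b"
    using bounded_subset_cbox_symmetric[OF assms(1)]
    by (metis atLeastatMost_empty_iff2 box_real(2) empty_subsetI order_refl subset_empty)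
  from covering_exists[OF this assms(2)]
  show "\<exists>A. finite A \<and> card A = covering_number F \<delta> \<and> F \<subseteq> (\<Union>a\<in>A. {a..a + \<delta>})"
    unfolding covering_number_def by (intro LeastI_ex[where P = "\<lambda>n. \<exists>A. finite A \<and> card A = n \<and> _ A"]) blast
  show "covering_number F \<delta> \<le> card A" if "finite A" "F \<subseteq> (\<Union>a\<in>A. {a..a + \<delta>})" for A
    unfolding covering_number_def using that by (intro Least_le) blast
qed

lemma upper_minkowski_dim_bounded:
  assumes "bounded F" "F \<noteq> {}"
  shows "upper_minkowski_limsup F = ereal (upper_minkowski_dim F)"
    and "0 \<le> upper_minkowski_dim F" "upper_minkowski_dim F \<le> 1"
proof -
  obtain a b where ab: "F \<subseteq> {a..b}" "a \<le> b"
    using bounded_subset_cbox_symmetric[OF assms(1)]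
    by (metis atLeastatMost_empty_iff2 box_real(2) empty_subsetI order_refl subset_empty)
  have pos: "covering_number F \<delta> \<ge> 1" if "\<delta> > 0" for \<delta>
    using covering_number_props(1)[OF assms(1) that] assms(2)
    by (metis One_nat_def SUP_bot_conv(2) Suc_leI card_gt_0_iff gr0I card_0_eq UN_empty subset_empty)
  have up: "real (covering_number F \<delta>) \<le> (b - a + 2) / \<delta>" if "\<delta> > 0" "\<delta> < 1" for \<delta>
  proof -
    have "covering_number F \<delta> \<le> nat \<lceil>(b - a) / \<delta>\<rceil> + 1"
      using covering_exists[OF ab that(1)] covering_number_props(2)[OF assms(1) that(1)]
      by (meson le_trans)
    moreover have "(b - a) / \<delta> \<ge> 0" using ab that by simp
    ultimately have "real (covering_number F \<delta>) \<le> (b - a) / \<delta> + 2" by linarith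
    also have "\<dots> \<le> (b - a + 2) / \<delta>" using that by (simp add: field_simps)
    finally show ?thesis .
  qed
  have ev: "eventually (\<lambda>\<delta>::real. 0 < \<delta> \<and> \<delta> < 1) (at_right 0)"
    by (auto simp: eventually_at_right_field intro!: exI[of _ 1])
  have "0 \<le> upper_minkowski_limsup F"
    unfolding upper_minkowski_limsup_def
  proof (rule le_Limsup)
    show "eventually (\<lambda>\<delta>. 0 \<le> ereal (ln (real (covering_number F \<delta>)) / ln (1 / \<delta>))) (at_right 0)"
      using ev
    proof eventually_elim
      case (elim \<delta>)
      with pos[of \<delta>] show ?case by (auto intro!: divide_nonneg_nonneg)
    qed
  qed simp
  moreover have "upper_minkowski_limsup F \<le> 1"
  proof -
    have "((\<lambda>\<delta>::real. ln (b - a + 2) / ln (1 / \<delta>) + 1) \<longlongrightarrow> 1) (at_right 0)"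
      by real_asymp
    then have lim: "((\<lambda>\<delta>::real. ereal (ln (b - a + 2) / ln (1 / \<delta>) + 1)) \<longlongrightarrow> ereal 1) (at_right 0)"
      by (rule tendsto_ereal)
    have "upper_minkowski_limsup F \<le> Limsup (at_right 0) (\<lambda>\<delta>. ereal (ln (b - a + 2) / ln (1 / \<delta>) + 1))"
      unfolding upper_minkowski_limsup_def
    proof (rule Limsup_mono, use ev in eventually_elim)
      case (elim \<delta>)
      have l: "ln (1 / \<delta>) > 0" using elim by simp
      have "ln (real (covering_number F \<delta>)) \<le> ln ((b - a + 2) / \<delta>)"
        using pos[of \<delta>] up[of \<delta>] elim ab by (subst ln_le_cancel_iff) auto
      also have "\<dots> = ln (b - a + 2) + ln (1 / \<delta>)"
        using elim ab by (simp add: ln_div)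
      finally have "ln (real (covering_number F \<delta>)) / ln (1 / \<delta>)
          \<le> (ln (b - a + 2) + ln (1 / \<delta>)) / ln (1 / \<delta>)"
        using l by (intro divide_right_mono) auto
      then show ?case using l by (simp add: add_divide_distrib)
    qed
    also have "\<dots> = ereal 1" by (rule lim_imp_Limsup[OF _ lim]) simp
    finally show ?thesis by (simp add: one_ereal_def)
  qed
  ultimately show "upper_minkowski_limsup F = ereal (upper_minkowski_dim F)"
      "0 \<le> upper_minkowski_dim F" "upper_minkowski_dim F \<le> 1"
    unfolding upper_minkowski_dim_def
    by (cases "upper_minkowski_limsup F"; simp)+
qed

definition E_star :: "real set \<Rightarrow> real set \<Rightarrow> real set" where
  "E_star E1 E2 = {t1 * t2 / sqrt (t1\<^sup>2 + t2\<^sup>2) | t1 t2. t1 \<in> E1 \<and> t2 \<in> E2}"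

end

(* Test the bound on f = g = the indicator of the ball of radius 4h about the origin. If |x| is
   within h of t = t1 t2 / sqrt (t1^2 + t2^2), then t / |x| * (x / t1, x / t2) lies on the unit
   sphere, and the cap of radius h around it, of measure about h^(2d-1), is contained in the set
   where the integrand is 1. Such x fill annuli of total volume at least about h N(E_star, h).
   Hence h^(2d-1) (h N(E_star, h))^(1/r) is at most a constant times h^(d/p + d/q); take
   logarithms and let h tend to 0. *)
theory Submission
  imports Defs
begin

section \<open>Spherical caps and the pointwise lower bound\<close>

text \<open>The measure of a cap is the share of the unit ball taken up by the cone over it. That
  cone contains about \<open>1 / h\<close> disjoint balls of radius \<open>h / 4\<close> strung
  along the ray through \<open>w\<close>, each with share \<open>(h / 4) ^ DIM('a)\<close>; their
  number turns the exponent into \<open>DIM('a) - 1\<close>.\<close>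

lemma sphere_measure_cap_ge:
  fixes w :: "'a::euclidean_space"
  assumes w: "norm w = 1" and h: "0 < h" "h \<le> 1"
  shows "(h / 4) ^ DIM('a) / (2 * h) \<le> measure sphere_measure (cball w h)"
proof -
  let ?U = "uniform_measure lborel (ball (0::'a) 1)"
  let ?V = "(\<lambda>x::'a. x /\<^sub>R norm x) -` cball w h"
  \<comment> \<open>The centres \<open>s k *\<^sub>R w\<close> start at radius 1/2 and are spaced
    \<open>h / 2\<close>, so \<open>n\<close> balls fit below radius 1. As \<open>h \<le> 1\<close>,
    rounding down costs at most a factor 2.\<close>
  define n where "n = nat \<lfloor>1 / h\<rfloor>"
  define s where "s k = 1 / 2 + real k * h / 2" for k
  define B where "B k = ball (s k *\<^sub>R w) (h / 4)" for k
  have inv: "1 / h \<ge> 1" using h by simp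
  have n_le: "real n \<le> 1 / h" and n_ge: "1 / (2 * h) \<le> real n"
  proof -
    show "real n \<le> 1 / h" using inv unfolding n_def by linarith
    have "1 \<le> \<lfloor>1 / h\<rfloor>" using inv by simp
    then have "1 / h \<le> 2 * real n" unfolding n_def by linarith
    then show "1 / (2 * h) \<le> real n" using h by (simp add: field_simps)
  qed
  have s_le: "s k + h / 4 \<le> 1" if "k < n" for k
  proof -
    have "real k + 1 \<le> 1 / h" using that n_le by linarith
    then have "(real k + 1) * h \<le> 1" using h by (simp add: field_simps)
    then show ?thesis using h by (simp add: s_def algebra_simps)
  qed
  have sub: "B k \<subseteq> ?V \<inter> ball 0 1" if k: "k < n" for k
  proof
    fix x assume "x \<in> B k"
    then have x: "norm (x - s k *\<^sub>R w) < h / 4"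
      by (simp add: B_def dist_norm norm_minus_commute)
    have s_ge: "s k \<ge> 1 / 2" using h by (simp add: s_def)
    have ns: "norm (s k *\<^sub>R w) = s k" using s_ge w by simp
    have near: "\<bar>norm x - s k\<bar> < h / 4"
      using norm_triangle_ineq3[of x "s k *\<^sub>R w"] x ns by linarith
    then have nx: "norm x > 0" using s_ge h by linarith
    \<comment> \<open>Splits the error of the direction into a radial part and a displacement part.
      Each has norm below \<open>h / 4\<close> divided by \<open>s k \<ge> 1 / 2\<close>, so
      together they stay within \<open>h\<close>.\<close>
    have "x /\<^sub>R norm x - w = (s k - norm x) *\<^sub>R (x /\<^sub>R (norm x * s k)) + (x - s k *\<^sub>R w) /\<^sub>R s k"
    proof -
      have "(s k - norm x) / (norm x * s k) = 1 / norm x - 1 / s k"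
        using nx s_ge by (simp add: diff_divide_distrib)
      then have "(s k - norm x) *\<^sub>R (x /\<^sub>R (norm x * s k)) = x /\<^sub>R norm x - x /\<^sub>R s k"
        by (simp add: divide_inverse_commute scaleR_diff_left[symmetric] mult.commute)
      then show ?thesis using s_ge by (simp add: scaleR_diff_right)
    qed
    also have "norm \<dots> \<le> norm ((s k - norm x) *\<^sub>R (x /\<^sub>R (norm x * s k))) + norm ((x - s k *\<^sub>R w) /\<^sub>R s k)"
      by (rule norm_triangle_ineq)
    also have "\<dots> = (\<bar>norm x - s k\<bar> + norm (x - s k *\<^sub>R w)) / s k"
    proof -
      have "\<bar>b - a\<bar> * (\<bar>inverse (a * b)\<bar> * a) + \<bar>inverse b\<bar> * e = (\<bar>a - b\<bar> + e) / b"
        if "a > 0" "b > 0" for a b e :: real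
        using that by (simp add: field_simps abs_mult abs_minus_commute)
      from this[of "norm x" "s k"] show ?thesis
        unfolding norm_scaleR using nx s_ge by simp
    qed
    also have "\<dots> \<le> (h / 2) / (1 / 2)"
      using near x s_ge h by (intro frac_le) auto
    finally have "norm (x /\<^sub>R norm x - w) \<le> h" by simp
    moreover have "norm x < 1" using near s_le[OF k] by linarith
    ultimately show "x \<in> ?V \<inter> ball 0 1" by (simp add: dist_norm norm_minus_commute)
  qed
  have disj: "disjoint_family_on B {..<n}"
    unfolding disjoint_family_on_def
  proof (intro ballI impI)
    fix i j :: nat assume "i \<noteq> j"
    then have ij: "1 \<le> \<bar>real i - real j\<bar>" by linarith
    have "dist (s i *\<^sub>R w) (s j *\<^sub>R w) = \<bar>s i - s j\<bar>"
      using w by (simp add: dist_norm flip: scaleR_diff_left)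
    also have "s i - s j = (real i - real j) * (h / 2)"
      by (simp add: s_def algebra_simps)
    also have "\<bar>\<dots>\<bar> = \<bar>real i - real j\<bar> * (h / 2)" using h by (simp add: abs_mult)
    \<comment> \<open>Distinct centres are at least \<open>h / 2\<close> apart, the sum of the two
      radii, and the balls are open.\<close>
    finally have "dist (s i *\<^sub>R w) (s j *\<^sub>R w) \<ge> h / 4 + h / 4"
      using mult_right_mono[OF ij, of "h / 2"] h by simp
    then show "B i \<inter> B j = {}"
      unfolding B_def by (rule disjoint_ballI)
  qed
  let ?v = "unit_ball_vol (real DIM('a))"
  have v: "?v > 0" by simp
  have V [measurable]: "?V \<in> sets borel"
  proof -
    have "(\<lambda>x::'a. x /\<^sub>R norm x) \<in> borel_measurable borel" by measurable
    from measurable_sets[OF this, of "cball w h"] show ?thesis by simp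
  qed
  have "real n * (?v * (h / 4) ^ DIM('a)) = (\<Sum>k<n. measure lborel (B k))"
    using h by (simp add: B_def content_ball)
  also have "\<dots> = measure lborel (\<Union>k<n. B k)"
    using disj emeasure_lborel_ball_finite unfolding B_def
    by (intro measure_finite_Union[symmetric]) (auto simp: less_top)
  also have "\<dots> \<le> measure lborel (ball 0 1 \<inter> ?V)"
  proof (rule measure_mono_fmeasurable)
    have "ball (0::'a) 1 \<in> fmeasurable lborel"
      using emeasure_lborel_ball_finite by (intro fmeasurableI) auto
    then show "ball 0 1 \<inter> ?V \<in> fmeasurable lborel"
      by (rule fmeasurable_Int_fmeasurable) simp
  qed (use sub in \<open>auto simp: B_def\<close>)
  finally have *: "real n * (?v * (h / 4) ^ DIM('a)) \<le> measure lborel (ball 0 1 \<inter> ?V)" .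
  have "measure sphere_measure (cball w h) = measure ?U ?V"
    unfolding sphere_measure_def by (subst measure_distr) auto
  also have "\<dots> = measure lborel (ball 0 1 \<inter> ?V) / ?v"
    using emeasure_unit_ball
    by (subst measure_uniform_measure) (auto simp: content_ball)
  also have "\<dots> \<ge> real n * (h / 4) ^ DIM('a)"
    using * v by (simp add: field_simps)
  finally have "real n * (h / 4) ^ DIM('a) \<le> measure sphere_measure (cball w h)" .
  moreover have "1 / (2 * h) * (h / 4) ^ DIM('a) \<le> real n * (h / 4) ^ DIM('a)"
    using n_ge h by (intro mult_right_mono) auto
  ultimately show ?thesis by simp
qed

text \<open>Fix the radii \<open>t1\<close>, \<open>t2\<close> that produce \<open>t\<close> and
  project \<open>x\<close> radially to a point \<open>u\<close> of norm \<open>t\<close>. Then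
  \<open>(u /\<^sub>R t1, u /\<^sub>R t2)\<close> is a unit vector, and on the cap of radius
  \<open>h\<close> around it both factors of the integrand equal 1.\<close>

lemma bilinear_spherical_maximal_ball_ge:
  fixes x :: "real ^ 'n"
  assumes E: "E1 \<subseteq> {1..2}" "E2 \<subseteq> {1..2}"
    and t: "t \<in> E_star E1 E2" and near: "\<bar>norm x - t\<bar> \<le> h" and x: "x \<noteq> 0"
    and h: "0 < h" "h \<le> 1"
  defines "f \<equiv> \<lambda>x. complex_of_real (indicator (ball 0 (4 * h)) x)"
  shows "ennreal ((h / 4) ^ (2 * CARD('n)) / (2 * h)) \<le> bilinear_spherical_maximal E1 E2 f f x"
proof -
  obtain t1 t2 where t12: "t1 \<in> E1" "t2 \<in> E2" "t = t1 * t2 / sqrt (t1\<^sup>2 + t2\<^sup>2)"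
    using t by (auto simp: E_star_def)
  have b: "1 \<le> t1" "t1 \<le> 2" "1 \<le> t2" "t2 \<le> 2" using E t12 by auto
  have sq: "t1\<^sup>2 + t2\<^sup>2 > 0" using b by (simp add: add_pos_pos)
  have t0: "t > 0" using b sq t12 by simp
  \<comment> \<open>This is where the formula for \<open>E_star\<close> comes from: \<open>t\<close>
    is the reciprocal of the norm of the vector with entries \<open>1 / t1\<close> and
    \<open>1 / t2\<close>.\<close>
  have t2sq: "t\<^sup>2 * (1 / t1\<^sup>2 + 1 / t2\<^sup>2) = 1"
  proof -
    have *: "x * y / (x + y) * (1 / x + 1 / y) = 1" if "x > 0" "y > 0" for x y :: real
      using that by (simp add: divide_simps add.commute)
    have tt: "t\<^sup>2 = t1\<^sup>2 * t2\<^sup>2 / (t1\<^sup>2 + t2\<^sup>2)"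
      using sq by (simp add: t12(3) power_divide power_mult_distrib)
    show ?thesis unfolding tt by (rule *) (use b in auto)
  qed
  define u where "u = (t / norm x) *\<^sub>R x"
  have nu: "norm u = t" using x t0 by (simp add: u_def)
  have xu: "norm (x - u) \<le> h"
  proof -
    have "x - u = (1 - t / norm x) *\<^sub>R x" by (simp add: u_def algebra_simps)
    then have "norm (x - u) = \<bar>(1 - t / norm x) * norm x\<bar>" by (simp add: abs_mult)
    also have "(1 - t / norm x) * norm x = norm x - t" using x by (simp add: field_simps)
    finally show ?thesis using near by simp
  qed
  define w where "w = (u /\<^sub>R t1, u /\<^sub>R t2)"
  have "(norm w)\<^sup>2 = t\<^sup>2 * (1 / t1\<^sup>2 + 1 / t2\<^sup>2)"
    using b nu by (simp add: w_def norm_Pair power_divide power_inverse field_simps)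
  then have nw: "norm w = 1" using t2sq by (simp add: abs_square_eq_1)
  define W where "W = {z :: (real^'n) \<times> (real^'n). x - t1 *\<^sub>R fst z \<in> ball 0 (4 * h) \<and> x - t2 *\<^sub>R snd z \<in> ball 0 (4 * h)}"
  have W [measurable]: "W \<in> sets borel"
  proof -
    have "open W" unfolding W_def mem_ball dist_norm
      by (intro open_Collect_conj open_Collect_less continuous_intros)
    then show ?thesis by simp
  qed
  \<comment> \<open>The radius \<open>4 * h\<close> of the test ball leaves room for an error
    \<open>h\<close> from \<open>x - u\<close> plus \<open>2 * h\<close> from moving inside the cap,
    since the dilations are at most 2.\<close>
  have close: "norm (x - s *\<^sub>R y) < 4 * h"
    if s: "1 \<le> s" "s \<le> 2" and y: "norm (y - u /\<^sub>R s) \<le> h" for s y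
  proof -
    have "x - s *\<^sub>R y = (x - u) - s *\<^sub>R (y - u /\<^sub>R s)" using s by (simp add: algebra_simps)
    also have "norm \<dots> \<le> norm (x - u) + norm (s *\<^sub>R (y - u /\<^sub>R s))" by (rule norm_triangle_ineq4)
    also have "norm (s *\<^sub>R (y - u /\<^sub>R s)) \<le> 2 * h"
      unfolding norm_scaleR using s y h by (intro mult_mono) auto
    finally show ?thesis using xu h by linarith
  qed
  have "cball w h \<subseteq> W"
  proof
    fix z assume "z \<in> cball w h"
    then have z: "norm (z - w) \<le> h" by (simp add: dist_norm norm_minus_commute)
    have zw: "z - w = (fst z - u /\<^sub>R t1, snd z - u /\<^sub>R t2)"
      by (simp add: w_def prod_eq_iff)
    have "norm (fst z - u /\<^sub>R t1) \<le> h" "norm (snd z - u /\<^sub>R t2) \<le> h"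
      using z norm_fst_le norm_snd_le unfolding zw by (blast intro: order_trans)+
    then show "z \<in> W" using close b by (simp add: W_def)
  qed
  have fin: "finite_measure (sphere_measure :: ((real^'n) \<times> (real^'n)) measure)"
    using prob_space_sphere_measure by (rule prob_space.finite_measure)
  have dim: "DIM((real^'n) \<times> (real^'n)) = 2 * CARD('n)" by simp
  have "(h / 4) ^ (2 * CARD('n)) / (2 * h) \<le> measure sphere_measure (cball w h)"
    using sphere_measure_cap_ge[OF nw h] unfolding dim .
  also have "\<dots> \<le> measure sphere_measure W"
    by (rule finite_measure.finite_measure_mono[OF fin \<open>cball w h \<subseteq> W\<close>]) simp
  also have "\<dots> = cmod (LINT z|sphere_measure. complex_of_real (indicator W z))"
    by simp
  also have "(\<lambda>z. complex_of_real (indicator W z)) = (\<lambda>z. f (x - t1 *\<^sub>R fst z) * f (x - t2 *\<^sub>R snd z))"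
    by (auto simp: f_def W_def indicator_def)
  finally have "ennreal ((h / 4) ^ (2 * CARD('n)) / (2 * h)) \<le>
      ennreal (cmod (LINT z|sphere_measure. f (x - t1 *\<^sub>R fst z) * f (x - t2 *\<^sub>R snd z)))"
    by (rule ennreal_leI)
  also have "\<dots> \<le> bilinear_spherical_maximal E1 E2 f f x"
    unfolding bilinear_spherical_maximal_def
    using t12 by (intro SUP_upper2[of t1] SUP_upper2[of t2]) auto
  finally show ?thesis .
qed

section \<open>Annuli and covering numbers\<close>

text \<open>Replacing \<open>a ^ m\<close> by \<open>b ^ m\<close> in \<open>a * a ^ m\<close> gives
  the bound. It uses the outer radius because only that one is bounded below for the annuli
  considered later; their inner radius may be 0.\<close>

lemma measure_annulus_ge:
  fixes a b :: real
  assumes "0 \<le> a" "a \<le> b"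
  shows "unit_ball_vol (real DIM('a)) * ((b - a) * b ^ (DIM('a) - 1))
           \<le> measure lborel (ball (0::'a::euclidean_space) b - ball 0 a)"
proof -
  obtain m where m: "DIM('a) = Suc m" using DIM_positive[where 'a='a] gr0_implies_Suc by blast
  have "a * a ^ m \<le> a * b ^ m" using assms by (intro mult_left_mono power_mono) auto
  then have "(b - a) * b ^ (DIM('a) - 1) \<le> b ^ DIM('a) - a ^ DIM('a)"
    unfolding m by (simp add: algebra_simps)
  then have "unit_ball_vol (real DIM('a)) * ((b - a) * b ^ (DIM('a) - 1))
      \<le> unit_ball_vol (real DIM('a)) * (b ^ DIM('a) - a ^ DIM('a))"
    by (intro mult_left_mono) auto
  also have "\<dots> = measure lborel (ball (0::'a) b - ball 0 a)"
    using assms emeasure_lborel_ball_finite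
    by (subst measure_Diff) (auto simp: content_ball less_top algebra_simps)
  finally show ?thesis .
qed

text \<open>The lower bound keeps the radii away from 0, so that an annulus of width
  \<open>h\<close> has volume at least of order \<open>h\<close>; the upper bound makes the covering
  numbers meaningful.\<close>

lemma E_star_bounds:
  assumes E: "E1 \<subseteq> {1..2}" "E2 \<subseteq> {1..2}" and t: "t \<in> E_star E1 E2"
  shows "1 / 2 \<le> t" "t \<le> 2"
proof -
  obtain t1 t2 where t12: "t1 \<in> E1" "t2 \<in> E2" "t = t1 * t2 / sqrt (t1\<^sup>2 + t2\<^sup>2)"
    using t by (auto simp: E_star_def)
  have b: "1 \<le> t1" "t1 \<le> 2" "1 \<le> t2" "t2 \<le> 2" using E t12 by auto
  have sq: "sqrt (t1\<^sup>2 + t2\<^sup>2) > 0" using b by (simp add: add_pos_pos)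
  have "sqrt (t1\<^sup>2 + t2\<^sup>2) \<le> t1 + t2" using b by (intro sqrt_sum_squares_le_sum) auto
  moreover have "t1 \<le> t1 * t2" "t2 \<le> t1 * t2" using b by simp_all
  ultimately have "sqrt (t1\<^sup>2 + t2\<^sup>2) \<le> 2 * (t1 * t2)" by linarith
  then show "1 / 2 \<le> t" using sq by (simp add: t12(3) field_simps)
  have "t1 \<le> sqrt (t1\<^sup>2 + t2\<^sup>2)" using b by (intro real_le_rsqrt) simp
  then have "t1 * t2 \<le> sqrt (t1\<^sup>2 + t2\<^sup>2) * 2" using b by (intro mult_mono) auto
  then show "t \<le> 2" using sq by (simp add: t12(3) field_simps)
qed

text \<open>The cells of the grid of mesh \<open>h\<close> that meet \<open>F\<close> cover it, so
  there are at least \<open>covering_number F h\<close> of them. The annuli over these cells are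
  disjoint, and each has volume at least of order \<open>h\<close>. Points whose norm shares a cell
  with some \<open>t\<close> in \<open>F\<close> are within \<open>h\<close> of it.\<close>

lemma annular_set_measure_ge:
  fixes F :: "real set"
  assumes F: "F \<subseteq> {a..b}" and a: "0 < a" and h: "0 < h"
  obtains S :: "'a::euclidean_space set"
  where "S \<in> sets borel" "emeasure lborel S \<noteq> \<infinity>"
    "unit_ball_vol (real DIM('a)) * a ^ (DIM('a) - 1) * (h * real (covering_number F h)) \<le> measure lborel S"
    "\<And>x. x \<in> S \<Longrightarrow> \<exists>t\<in>F. \<bar>norm x - t\<bar> \<le> h"
proof -
  \<comment> \<open>Half-open cells make the annuli disjoint, and they match exactly the norms
    occurring in a difference of two open balls.\<close>
  define cell where "cell k = {real k * h..<real (Suc k) * h}" for k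
  define A where "A = {k. cell k \<inter> F \<noteq> {}}"
  define R where "R k = ball (0::'a) (real (Suc k) * h) - ball 0 (real k * h)" for k
  define S where "S = (\<Union>k\<in>A. R k)"
  have cell_ex: "t \<in> cell (nat \<lfloor>t / h\<rfloor>)" if "t \<ge> 0" for t
  proof -
    have "0 \<le> t / h" using that h by simp
    then have "real (nat \<lfloor>t / h\<rfloor>) \<le> t / h" "t / h < real (Suc (nat \<lfloor>t / h\<rfloor>))" by linarith+
    then show ?thesis using h by (simp add: cell_def field_simps)
  qed
  have "A \<subseteq> {..nat \<lfloor>b / h\<rfloor>}"
  proof
    fix k assume "k \<in> A"
    then obtain t where "t \<in> cell k" "t \<in> F" by (auto simp: A_def)
    then have "real k * h \<le> b" using F by (force simp: cell_def)
    then have "real k \<le> b / h" using h by (simp add: field_simps)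
    then show "k \<in> {..nat \<lfloor>b / h\<rfloor>}" by (simp add: le_nat_floor)
  qed
  then have finA: "finite A" by (rule finite_subset) simp
  have "covering_number F h \<le> card ((\<lambda>k. real k * h) ` A)"
  proof (rule covering_number_props(2))
    show "bounded F" using F bounded_closed_interval bounded_subset by blast
    show "F \<subseteq> (\<Union>a\<in>(\<lambda>k. real k * h) ` A. {a..a + h})"
    proof
      fix t assume t: "t \<in> F"
      then have c: "t \<in> cell (nat \<lfloor>t / h\<rfloor>)" using F a cell_ex by force
      then have "nat \<lfloor>t / h\<rfloor> \<in> A" using t by (auto simp: A_def)
      moreover have "t \<in> {real (nat \<lfloor>t / h\<rfloor>) * h..real (nat \<lfloor>t / h\<rfloor>) * h + h}"
        using c by (simp add: cell_def algebra_simps)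
      ultimately show "t \<in> (\<Union>a\<in>(\<lambda>k. real k * h) ` A. {a..a + h})" by blast
    qed
  qed (use finA h in auto)
  also have "\<dots> \<le> card A" using finA by (rule card_image_le)
  finally have cov: "real (covering_number F h) \<le> real (card A)" by simp
  have R: "x \<in> R k \<longleftrightarrow> norm x \<in> cell k" for x k by (auto simp: R_def cell_def)
  have Rset: "R k \<in> sets lborel" for k by (simp add: R_def)
  have Rfin: "emeasure lborel (R k) \<noteq> \<infinity>" for k
  proof -
    have "emeasure lborel (R k) \<le> emeasure lborel (ball (0::'a) (real (Suc k) * h))"
      by (intro emeasure_mono) (auto simp: R_def)
    also have "\<dots> < \<infinity>" using emeasure_lborel_ball_finite by blast
    finally show ?thesis by simp
  qed
  have disj: "disjoint_family_on R A"
    unfolding disjoint_family_on_def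
  proof (intro ballI impI)
    fix i j :: nat assume "i \<noteq> j"
    have False if x: "norm x \<in> cell i" "norm x \<in> cell j" for x :: 'a
    proof -
      have "real i * h < real (Suc j) * h" "real j * h < real (Suc i) * h"
        using x by (auto simp: cell_def)
      then show False using h \<open>i \<noteq> j\<close> by simp
    qed
    then show "R i \<inter> R j = {}" by (auto simp: R)
  qed
  let ?v = "unit_ball_vol (real DIM('a))"
  have "?v * a ^ (DIM('a) - 1) * (h * real (covering_number F h))
      \<le> ?v * a ^ (DIM('a) - 1) * (h * real (card A))"
    using cov h a by (intro mult_left_mono mult_nonneg_nonneg) auto
  also have "\<dots> = (\<Sum>k\<in>A. ?v * (h * a ^ (DIM('a) - 1)))" by simp
  also have "\<dots> \<le> (\<Sum>k\<in>A. measure lborel (R k))"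
  proof (rule sum_mono)
    fix k assume "k \<in> A"
    then obtain t where "t \<in> cell k" "t \<in> F" by (auto simp: A_def)
    \<comment> \<open>A cell meeting \<open>F\<close> may begin below \<open>a\<close>, but its
      right end lies beyond \<open>a\<close>.\<close>
    then have "a \<le> real (Suc k) * h" using F by (force simp: cell_def)
    then have "?v * (h * a ^ (DIM('a) - 1)) \<le> ?v * (h * (real (Suc k) * h) ^ (DIM('a) - 1))"
      using a h by (intro mult_left_mono power_mono) auto
    also have "\<dots> = ?v * ((real (Suc k) * h - real k * h) * (real (Suc k) * h) ^ (DIM('a) - 1))"
      by (simp add: algebra_simps)
    also have "\<dots> \<le> measure lborel (R k)"
      unfolding R_def using h by (intro measure_annulus_ge) auto
    finally show "?v * (h * a ^ (DIM('a) - 1)) \<le> measure lborel (R k)" .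
  qed
  also have "\<dots> = measure lborel S"
    unfolding S_def using finA Rset Rfin disj
    by (intro measure_finite_Union[symmetric]) (auto simp: less_top)
  finally have meas: "?v * a ^ (DIM('a) - 1) * (h * real (covering_number F h)) \<le> measure lborel S" .
  show ?thesis
  proof (rule that)
    show "S \<in> sets borel" unfolding S_def using finA Rset by auto
    have "emeasure lborel S \<le> (\<Sum>k\<in>A. emeasure lborel (R k))"
      unfolding S_def using finA Rset by (intro emeasure_subadditive_finite) auto
    also have "\<dots> < \<infinity>"
      using Rfin finA by (simp add: ennreal_sum_less_top less_top)
    finally show "emeasure lborel S \<noteq> \<infinity>" by simp
    show "\<exists>t\<in>F. \<bar>norm x - t\<bar> \<le> h" if x: "x \<in> S" for x
    proof -
      obtain k t where "norm x \<in> cell k" "t \<in> cell k" "t \<in> F" using x by (auto simp: S_def A_def R)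
      then show ?thesis by (intro bexI[of _ t]) (auto simp: cell_def algebra_simps)
    qed
  qed (rule meas)
qed

section \<open>Lebesgue norms, with infinite exponents included\<close>

text \<open>At the exponents 0 and infinity both sides are 0 by the default values of
  \<open>enn2real\<close> and of real division.\<close>

lemma enn2real_one_divide: "enn2real (1 / p) = 1 / enn2real p"
proof (cases p)
  case (real x)
  then show ?thesis
    by (cases "x = 0") (simp_all add: divide_ennreal flip: ennreal_1)
qed simp

text \<open>One formula serves every exponent: for infinite \<open>p\<close> the power is
  \<open>m powr 0\<close>, which is 1 because \<open>m\<close> is positive.\<close>

lemma Lp_norm_indicator_le:
  fixes B :: "'a set"
  assumes B: "B \<in> sets M" "emeasure M B = ennreal m" and m: "0 < m" and p: "0 < p"
  shows "Lp_norm p M (\<lambda>x. ennreal (cmod (complex_of_real (indicator B x)))) \<le> ennreal (m powr enn2real (1 / p))"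
proof (cases "p = \<infinity>")
  case True
  have "Inf {c. AE x in M. ennreal (cmod (complex_of_real (indicator B x))) \<le> c} \<le> 1"
    by (rule Inf_lower) (auto simp: indicator_def)
  then show ?thesis using True m by (simp add: Lp_norm_def)
next
  case False
  then have ep: "enn2real p > 0" using p by (simp add: enn2real_positive_iff less_top)
  have "(\<integral>\<^sup>+x. ennreal_powr (ennreal (cmod (complex_of_real (indicator B x)))) (enn2real p) \<partial>M)
      = (\<integral>\<^sup>+x. indicator B x \<partial>M)"
    by (intro nn_integral_cong) (auto simp: ennreal_powr_def indicator_def)
  also have "\<dots> = ennreal m" using B by simp
  finally show ?thesis using False m by (simp add: Lp_norm_def ennreal_powr_def enn2real_one_divide)
qed

lemma ennreal_powr_mono:
  assumes "x \<le> y" "0 \<le> a"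
  shows "ennreal_powr x a \<le> ennreal_powr y a"
proof (cases "y = \<infinity>")
  case False
  then have "x \<noteq> \<infinity>" "enn2real x \<le> enn2real y"
    using assms(1) by (auto simp: top_unique less_top intro: enn2real_mono)
  then show ?thesis using False assms(2) by (auto simp: ennreal_powr_def intro!: ennreal_leI powr_mono2)
qed (simp add: ennreal_powr_def)

lemma Lp_norm_ge:
  assumes S: "S \<in> sets M" "emeasure M S \<noteq> \<infinity>" "m \<le> measure M S" and m: "0 < m"
    and c: "0 < c" and F: "\<And>x. x \<in> S \<Longrightarrow> ennreal c \<le> F x" and r: "0 < r"
  shows "ennreal (c * m powr enn2real (1 / r)) \<le> Lp_norm r M F"
proof (cases "r = \<infinity>")
  case True
  have "ennreal c \<le> k" if ae: "AE x in M. F x \<le> k" for k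
  proof (rule ccontr)
    assume "\<not> ennreal c \<le> k"
    \<comment> \<open>An almost everywhere bound that is not above \<open>c\<close> would make
      \<open>S\<close> a null set, although its measure is at least \<open>m > 0\<close>.\<close>
    have "AE x in M. x \<notin> S" using ae
    proof eventually_elim
      case (elim x)
      then show ?case using F[of x] \<open>\<not> ennreal c \<le> k\<close> by (meson order_trans)
    qed
    then have "emeasure M S = 0" using S(1) by (simp add: AE_iff_null_sets null_setsD1)
    then show False using S(3) m by (simp add: measure_def)
  qed
  then show ?thesis using True m by (auto simp: Lp_norm_def intro: Inf_greatest)
next
  case False
  define s where "s = enn2real r"
  have s: "s > 0" using False r by (simp add: s_def enn2real_positive_iff less_top)
  have eS: "emeasure M S = ennreal (measure M S)" using S(2) by (simp add: emeasure_eq_ennreal_measure)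
  have "ennreal (c powr s * m) \<le> ennreal (c powr s * measure M S)"
    using S(3) by (intro ennreal_leI mult_left_mono) auto
  also have "\<dots> = (\<integral>\<^sup>+x. ennreal (c powr s) * indicator S x \<partial>M)"
    using S(1) by (simp add: nn_integral_cmult_indicator eS ennreal_mult)
  also have "\<dots> \<le> (\<integral>\<^sup>+x. ennreal_powr (F x) s \<partial>M)"
  proof (rule nn_integral_mono)
    fix x
    show "ennreal (c powr s) * indicator S x \<le> ennreal_powr (F x) s"
    proof (cases "x \<in> S")
      case True
      have "ennreal (c powr s) = ennreal_powr (ennreal c) s" using c by (simp add: ennreal_powr_def)
      also have "\<dots> \<le> ennreal_powr (F x) s" using F[OF True] s by (intro ennreal_powr_mono) auto
      finally show ?thesis using True by simp
    qed simp
  qed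
  finally have *: "ennreal (c powr s * m) \<le> (\<integral>\<^sup>+x. ennreal_powr (F x) s \<partial>M)" .
  have "ennreal (c * m powr (1 / s)) = ennreal_powr (ennreal (c powr s * m)) (1 / s)"
    using c m s by (simp add: ennreal_powr_def powr_mult powr_powr)
  also have "\<dots> \<le> ennreal_powr (\<integral>\<^sup>+x. ennreal_powr (F x) s \<partial>M) (1 / s)"
    using * s by (intro ennreal_powr_mono) auto
  finally show ?thesis using False by (simp add: Lp_norm_def s_def enn2real_one_divide)
qed

section \<open>From covering bounds to dimension\<close>

lemma covering_number_pos:
  assumes "bounded F" "F \<noteq> {}" "0 < h"
  shows "0 < covering_number F h"
  using covering_number_props(1)[OF assms(1,3)] assms(2) by (auto intro!: Nat.gr0I)

text \<open>The conclusion is multiplied by \<open>\<rho>\<close> because \<open>\<rho> = 0\<close> (the case \<open>r = \<infinity>\<close>) is allowed.\<close>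

lemma upper_minkowski_dim_le:
  fixes F :: "real set" and \<rho> s K h0 :: real
  assumes F: "bounded F" "F \<noteq> {}" and \<rho>: "0 \<le> \<rho>" and h0: "0 < h0"
    and bound: "\<And>h. 0 < h \<Longrightarrow> h < h0 \<Longrightarrow>
      \<rho> * ln (real (covering_number F h)) \<le> K + s * ln (1 / h)"
  shows "\<rho> * upper_minkowski_dim F \<le> s"
proof -
  have ev: "eventually (\<lambda>h::real. 0 < h \<and> h < min h0 1) (at_right 0)"
    using h0 by (auto simp: eventually_at_right_field intro!: exI[of _ "min h0 1"])
  have quot: "\<rho> * (ln (real (covering_number F h)) / ln (1 / h)) \<le> K / ln (1 / h) + s"
    if "0 < h \<and> h < min h0 1" for h
  proof -
    have L: "ln (1 / h) > 0" using that by simp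
    have "\<rho> * ln (real (covering_number F h)) / ln (1 / h) \<le> (K + s * ln (1 / h)) / ln (1 / h)"
      using bound[of h] that L by (intro divide_right_mono) auto
    then show ?thesis using L by (simp add: add_divide_distrib)
  qed
  have lim: "((\<lambda>h. K / ln (1 / h) + s) \<longlongrightarrow> s) (at_right 0)" by real_asymp
  show ?thesis
  \<comment> \<open>For \<open>\<rho> = 0\<close> the claim is only \<open>0 \<le> s\<close>,
    obtained by letting \<open>h\<close> tend to 0 in \<open>quot\<close>. Otherwise dividing by
    \<open>\<rho>\<close> allows a comparison of upper limits.\<close>
  proof (cases "\<rho> = 0")
    case True
    have "0 \<le> s"
      using lim by (rule tendsto_lowerbound) (use ev quot True in \<open>auto elim!: eventually_mono\<close>)
    then show ?thesis using True by simp
  next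
    case False
    then have \<rho>': "\<rho> > 0" using \<rho> by simp
    have lim': "((\<lambda>h. ereal ((K / ln (1 / h) + s) / \<rho>)) \<longlongrightarrow> ereal (s / \<rho>)) (at_right 0)"
      using \<rho>' by (intro tendsto_ereal tendsto_divide lim tendsto_const) auto
    have "upper_minkowski_limsup F \<le> Limsup (at_right 0) (\<lambda>h. ereal ((K / ln (1 / h) + s) / \<rho>))"
      unfolding upper_minkowski_limsup_def
    proof (rule Limsup_mono, use ev in eventually_elim)
      case (elim h)
      from quot[OF elim] \<rho>' show ?case by (simp add: pos_le_divide_eq mult.commute)
    qed
    also have "\<dots> = ereal (s / \<rho>)" by (rule lim_imp_Limsup[OF _ lim']) simp
    finally have "upper_minkowski_dim F \<le> s / \<rho>"
      using upper_minkowski_dim_bounded(1)[OF F] by simp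
    then show ?thesis using \<rho>' by (simp add: field_simps)
  qed
qed

section \<open>Testing on a small ball and comparing powers\<close>

theorem proposition7p7:
  fixes E1 E2 :: "real set"
    and \<beta>1 \<beta>2 \<beta>s :: real
    and p q r :: ennreal
  assumes "CARD('n::finite) \<ge> 2"
    and "E1 \<subseteq> {1..2}" "E1 \<noteq> {}"
    and "E2 \<subseteq> {1..2}" "E2 \<noteq> {}"
    and "upper_minkowski_dim E1 = \<beta>1"
    and "upper_minkowski_dim E2 = \<beta>2"
    and "upper_minkowski_dim (E_star E1 E2) = \<beta>s"
    and "1 \<le> p" "1 \<le> q" "0 < r"
    and "bounded_bilinear_Lp p q r
           (bilinear_spherical_maximal E1 E2 ::
              (real ^ 'n \<Rightarrow> complex) \<Rightarrow> (real ^ 'n \<Rightarrow> complex) \<Rightarrow> real ^ 'n \<Rightarrow> ennreal)"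
  shows "enn2real (1 / p) + enn2real (1 / q) \<le>
           (2 * real CARD('n) - 1) / real CARD('n)
           + (1 - \<beta>s) / real CARD('n) * enn2real (1 / r)"
proof -
  let ?d = "CARD('n)"
  let ?F = "E_star E1 E2"
  let ?T = "bilinear_spherical_maximal E1 E2 ::
              (real ^ 'n \<Rightarrow> complex) \<Rightarrow> (real ^ 'n \<Rightarrow> complex) \<Rightarrow> real ^ 'n \<Rightarrow> ennreal"
  \<comment> \<open>Reciprocal exponents, equal to 0 when the exponent is infinite.\<close>
  define P Q \<rho> where "P = enn2real (1 / p)" and "Q = enn2real (1 / q)" and "\<rho> = enn2real (1 / r)"
  define v where "v = unit_ball_vol (real ?d)"
  have v: "v > 0" by (simp add: v_def)
  have \<rho>: "\<rho> \<ge> 0" by (simp add: \<rho>_def)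
  have Fsub: "?F \<subseteq> {1/2..2}" using E_star_bounds[OF assms(2,4)] by auto
  have Fbd: "bounded ?F" using Fsub bounded_closed_interval bounded_subset by blast
  have Fne: "?F \<noteq> {}" using assms(3,5) by (auto simp: E_star_def)
  obtain C0 where C0: "C0 \<ge> 0" "\<And>f g. f \<in> Lp_space p \<Longrightarrow> g \<in> Lp_space q \<Longrightarrow>
      Lp_norm r lborel (?T f g) \<le> ennreal C0 * Lp_norm p lborel (\<lambda>x. ennreal (cmod (f x)))
                   * Lp_norm q lborel (\<lambda>x. ennreal (cmod (g x)))"
    using assms(12) unfolding bounded_bilinear_Lp_def by blast
  \<comment> \<open>The constant is made strictly positive so that its logarithm can be
    taken.\<close>
  define C where "C = C0 + 1"
  have C: "C > 0" "C0 \<le> C" using C0(1) by (auto simp: C_def)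
  \<comment> \<open>\<open>c1\<close> collects the constants of the cap bound
    \<open>(h / 4) ^ (2 * d) / (2 * h)\<close>; \<open>c2\<close> is the annulus constant for the
    lower radius 1/2 of \<open>E_star\<close>.\<close>
  define c1 c2 where "c1 = (1 / 4) ^ (2 * ?d) / (2::real)" and "c2 = v * (1 / 2) ^ (?d - 1)"
  have c12: "c1 > 0" "c2 > 0" using v by (auto simp: c1_def c2_def)
  have key: "c1 * h ^ (2 * ?d) / h * (c2 * (h * real (covering_number ?F h))) powr \<rho>
      \<le> C * (v * (4 * h) ^ ?d) powr P * (v * (4 * h) ^ ?d) powr Q"
    if h: "0 < h" "h < 1 / 4" for h
  proof -
    let ?B = "ball (0 :: real ^ 'n) (4 * h)"
    define f where "f = (\<lambda>x. complex_of_real (indicator ?B x))"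
    define m where "m = v * (4 * h) ^ ?d"
    have m: "m > 0" using v h by (simp add: m_def)
    have mB: "emeasure lborel ?B = ennreal m"
      using h by (simp add: emeasure_ball m_def v_def)
    have fnorm: "Lp_norm p' lborel (\<lambda>x. ennreal (cmod (f x))) \<le> ennreal (m powr enn2real (1 / p'))"
      if "1 \<le> p'" for p'
      unfolding f_def using mB m that
      by (intro Lp_norm_indicator_le) (auto intro: less_le_trans[of 0 1])
    have fLp: "f \<in> Lp_space p'" if "1 \<le> p'" for p'
    proof -
      have "f \<in> borel_measurable borel"
        unfolding f_def
        by (intro measurable_compose[OF borel_measurable_indicator]
            borel_measurable_continuous_onI continuous_intros) simp
      then show ?thesis using fnorm[OF that] by (auto simp: Lp_space_def intro: le_less_trans)
    qed
    obtain S :: "(real ^ 'n) set" where S: "S \<in> sets borel" "emeasure lborel S \<noteq> \<infinity>"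
      "c2 * (h * real (covering_number ?F h)) \<le> measure lborel S"
      "\<And>x. x \<in> S \<Longrightarrow> \<exists>t\<in>?F. \<bar>norm x - t\<bar> \<le> h"
      using annular_set_measure_ge[OF Fsub _ h(1), where 'a = "real ^ 'n"]
      unfolding c2_def v_def by auto
    have lower: "ennreal (c1 * h ^ (2 * ?d) / h) \<le> ?T f f x" if "x \<in> S" for x
    proof -
      obtain t where t: "t \<in> ?F" "\<bar>norm x - t\<bar> \<le> h" using S(4) \<open>x \<in> S\<close> by blast
      \<comment> \<open>\<open>norm x\<close> is at least \<open>1 / 2 - h\<close>, which exceeds
        1/4.\<close>
      then have "norm x > 0" using Fsub h by force
      then have "ennreal ((h / 4) ^ (2 * ?d) / (2 * h)) \<le> ?T f f x"
        unfolding f_def using assms(2,4) t h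
        by (intro bilinear_spherical_maximal_ball_ge) auto
      also have "(h / 4) ^ (2 * ?d) / (2 * h) = c1 * h ^ (2 * ?d) / h"
        by (simp add: c1_def power_divide)
      finally show ?thesis .
    qed
    have "ennreal (c1 * h ^ (2 * ?d) / h * (c2 * (h * real (covering_number ?F h))) powr \<rho>)
        \<le> Lp_norm r lborel (?T f f)"
      unfolding \<rho>_def using S(1-3) lower assms(11) c12 h covering_number_pos[OF Fbd Fne h(1)]
      by (intro Lp_norm_ge[of S]) auto
    also have "\<dots> \<le> ennreal C0 * Lp_norm p lborel (\<lambda>x. ennreal (cmod (f x)))
                   * Lp_norm q lborel (\<lambda>x. ennreal (cmod (f x)))"
      using fLp assms(9,10) by (intro C0(2)) auto
    also have "\<dots> \<le> ennreal C * ennreal (m powr P) * ennreal (m powr Q)"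
      unfolding P_def Q_def using fnorm assms(9,10) C by (intro mult_mono ennreal_leI) auto
    also have "\<dots> = ennreal (C * m powr P * m powr Q)"
      using C by (simp add: ennreal_mult)
    finally show ?thesis using C by (simp add: m_def)
  qed
  \<comment> \<open>Up to constants, \<open>key\<close> says that the covering number to the power
    \<open>\<rho>\<close> is at most \<open>(1 / h) powr ?s\<close>; \<open>K\<close> gathers the
    logarithms of the constants.\<close>
  let ?s = "(2 * real ?d - 1) + \<rho> - real ?d * (P + Q)"
  define K where "K = ln C + (P + Q) * (ln v + real ?d * ln 4) - ln c1 - \<rho> * ln c2"
  have "\<rho> * upper_minkowski_dim ?F \<le> ?s"
  proof (rule upper_minkowski_dim_le[OF Fbd Fne \<rho>, of "1 / 4" K])
    fix h :: real assume h: "0 < h" "h < 1 / 4"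
    let ?N = "real (covering_number ?F h)"
    have N: "?N > 0" using covering_number_pos[OF Fbd Fne h(1)] by simp
    have "ln (c1 * h ^ (2 * ?d) / h * (c2 * (h * ?N)) powr \<rho>)
        \<le> ln (C * (v * (4 * h) ^ ?d) powr P * (v * (4 * h) ^ ?d) powr Q)"
      using key[OF h] c12 h N C v by (subst ln_le_cancel_iff) auto
    also have "ln (c1 * h ^ (2 * ?d) / h * (c2 * (h * ?N)) powr \<rho>)
        = ln c1 + 2 * real ?d * ln h - ln h + \<rho> * (ln c2 + (ln h + ln ?N))"
      using c12 h N by (simp add: ln_mult ln_div ln_powr ln_realpow)
    also have "ln (C * (v * (4 * h) ^ ?d) powr P * (v * (4 * h) ^ ?d) powr Q)
        = ln C + P * (ln v + real ?d * (ln 4 + ln h)) + Q * (ln v + real ?d * (ln 4 + ln h))"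
      using C v h by (simp add: ln_mult ln_powr ln_realpow distrib_left)
    finally show "\<rho> * ln ?N \<le> K + ?s * ln (1 / h)"
      using h by (simp add: K_def ln_div algebra_simps)
  qed simp
  \<comment> \<open>The 1 in \<open>1 - \<beta>s\<close> is the exponent of the width
    \<open>h\<close> of the annuli, which contributes the summand \<open>\<rho>\<close> of
    \<open>?s\<close>.\<close>
  then have "real ?d * (P + Q) \<le> (2 * real ?d - 1) + (1 - \<beta>s) * \<rho>"
    using assms(8) by (simp add: algebra_simps)
  then have "P + Q \<le> ((2 * real ?d - 1) + (1 - \<beta>s) * \<rho>) / real ?d"
    by (simp add: pos_le_divide_eq mult.commute)
  then show ?thesis by (simp add: P_def Q_def \<rho>_def add_divide_distrib)
qed

end
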